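(* $T[H^\infty]=S[H^\infty]\subseteq M[H^\infty]=H^\infty$.
   Context: $\mathbb{D}$ is the open unit disk, $H(\mathbb{D})$ the set of analytic functions on $\mathbb{D}$, and $H^\infty$ the Banach space of bounded analytic functions on $\mathbb{D}$ with the supremum norm. For $g\in H(\mathbb{D})$ and $f\in H(\mathbb{D})$, define $T_gf(z)=\int_0^z f(t)g'(t)\,dt$, $S_gf(z)=\int_0^z f'(t)g(t)\,dt$, and $M_gf(z)=f(z)g(z)$, $z\in\mathbb{D}$. For $L\in\{T,S,M\}$ and a Banach space $X\subseteq H(\mathbb{D})$, $L[X]=\{g\in H(\mathbb{D}): L_g\text{ is bounded on }X\}$, where bounded on $X$ means that $L_g$ maps $X$ into $X$ and is a bounded linear operator there. *)

theory Defs
  imports "HOL-Complex_Analysis.Complex_Analysis"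
begin

abbreviation unit_disk :: "complex set" where
  "unit_disk \<equiv> ball 0 1"

text \<open>
  An analytic function on the unit disk is represented by its extension by 0 to the whole plane.
  Thus every element of \<open>H(D)\<close> has exactly one representative, so that equality of functions
  and of sets of functions is the intended one, and the pointwise vector space operations stay
  within the representatives.
\<close>

definition zero_off_disk :: "(complex \<Rightarrow> complex) \<Rightarrow> complex \<Rightarrow> complex" where
  "zero_off_disk f = (\<lambda>z. if z \<in> unit_disk then f z else 0)"

definition H_disk :: "(complex \<Rightarrow> complex) set" where
  "H_disk = {f. f holomorphic_on unit_disk \<and> (\<forall>z. z \<notin> unit_disk \<longrightarrow> f z = 0)}"

definition H_inf :: "(complex \<Rightarrow> complex) set" where
  "H_inf = {f \<in> H_disk. bounded (f ` unit_disk)}"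

definition H_inf_norm :: "(complex \<Rightarrow> complex) \<Rightarrow> real" where
  "H_inf_norm f = (SUP z\<in>unit_disk. norm (f z))"

text \<open>
  The integrals from \<open>0\<close> to \<open>z\<close> are taken along the segment, which lies in the disk; as the
  integrands are analytic there, the choice of path does not matter.
\<close>

definition T_op :: "(complex \<Rightarrow> complex) \<Rightarrow> (complex \<Rightarrow> complex) \<Rightarrow> complex \<Rightarrow> complex" where
  "T_op g f = zero_off_disk (\<lambda>z. contour_integral (linepath 0 z) (\<lambda>t. f t * deriv g t))"

definition S_op :: "(complex \<Rightarrow> complex) \<Rightarrow> (complex \<Rightarrow> complex) \<Rightarrow> complex \<Rightarrow> complex" where
  "S_op g f = zero_off_disk (\<lambda>z. contour_integral (linepath 0 z) (\<lambda>t. deriv f t * g t))"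

definition M_op :: "(complex \<Rightarrow> complex) \<Rightarrow> (complex \<Rightarrow> complex) \<Rightarrow> complex \<Rightarrow> complex" where
  "M_op g f = zero_off_disk (\<lambda>z. f z * g z)"

text \<open>
  Bounded linear operators on a space \<open>X\<close> of functions with norm \<open>N\<close>. Since \<open>X\<close> is a set rather
  than a type, the library's \<open>bounded_linear\<close> does not apply.
\<close>

definition bounded_operator_on ::
    "(complex \<Rightarrow> complex) set \<Rightarrow> ((complex \<Rightarrow> complex) \<Rightarrow> real) \<Rightarrow>
     ((complex \<Rightarrow> complex) \<Rightarrow> (complex \<Rightarrow> complex)) \<Rightarrow> bool" where
  "bounded_operator_on X N A \<longleftrightarrow>
     (\<forall>f\<in>X. A f \<in> X) \<and>
     (\<forall>f\<in>X. \<forall>h\<in>X. A (\<lambda>z. f z + h z) = (\<lambda>z. A f z + A h z)) \<and>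
     (\<forall>c. \<forall>f\<in>X. A (\<lambda>z. c * f z) = (\<lambda>z. c * A f z)) \<and>
     (\<exists>C. \<forall>f\<in>X. N (A f) \<le> C * N f)"

text \<open>The set \<open>L[X]\<close>, where \<open>L\<close> maps a symbol \<open>g\<close> to the operator \<open>L\<^sub>g\<close>.\<close>

definition symbols ::
    "((complex \<Rightarrow> complex) \<Rightarrow> (complex \<Rightarrow> complex) \<Rightarrow> (complex \<Rightarrow> complex)) \<Rightarrow>
     (complex \<Rightarrow> complex) set \<Rightarrow> ((complex \<Rightarrow> complex) \<Rightarrow> real) \<Rightarrow> (complex \<Rightarrow> complex) set" where
  "symbols L X N = {g \<in> H_disk. bounded_operator_on X N (L g)}"

end

theory Submission
  imports Defs
begin

text \<open>
  Integrating the product rule gives \<open>T\<^sub>g f + S\<^sub>g f = M\<^sub>g f - f(0) g(0)\<close>. If \<open>g\<close> is bounded,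
  the right-hand side is a bounded operator of \<open>f\<close>, so \<open>T\<^sub>g\<close> is bounded on \<open>H\<^sup>\<infinity>\<close> if and only if
  \<open>S\<^sub>g\<close> is. Everything therefore reduces to showing that each of the three operators can be
  bounded only if its symbol \<open>g\<close> is bounded.

  For \<open>M\<^sub>g\<close> and \<open>T\<^sub>g\<close> it is enough to test on the constant \<open>1\<close>, since \<open>M\<^sub>g 1 = g\<close> and
  \<open>T\<^sub>g 1 = g - g(0)\<close>. For \<open>S\<^sub>g\<close>, which annihilates constants, the test functions are the disk
  automorphisms \<open>\<phi>\<^sub>w(z) = (z - w) / (1 - cnj w z)\<close>: they lie in the unit ball of \<open>H\<^sup>\<infinity>\<close>, while
  \<open>\<phi>\<^sub>w'(w) = 1 / (1 - |w|\<^sup>2)\<close> is as large as the Cauchy estimate permits, up to a constant factor.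
  Hence \<open>|g(w)| = (1 - |w|\<^sup>2) |(S\<^sub>g \<phi>\<^sub>w)'(w)|\<close> is at most a multiple of the norm of \<open>S\<^sub>g\<close>
  (lemma \<open>symbol_S_imp_H_inf\<close>).
\<close>

section \<open>The space of bounded analytic functions\<close>

lemma H_infI:
  assumes "f holomorphic_on unit_disk" "\<And>z. z \<notin> unit_disk \<Longrightarrow> f z = 0"
    and "\<And>z. z \<in> unit_disk \<Longrightarrow> norm (f z) \<le> B"
  shows "f \<in> H_inf"
  using assms unfolding H_inf_def H_disk_def bounded_iff by blast

lemma H_inf_subset: "H_inf \<subseteq> H_disk"
  by (auto simp: H_inf_def)

lemma H_inf_holomorphic: "f \<in> H_inf \<Longrightarrow> f holomorphic_on unit_disk"
  and H_inf_off_disk: "f \<in> H_inf \<Longrightarrow> z \<notin> unit_disk \<Longrightarrow> f z = 0"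
  by (auto simp: H_inf_def H_disk_def)

lemma zero_off_disk_holomorphic [holomorphic_intros]:
  assumes "f holomorphic_on unit_disk"
  shows "zero_off_disk f holomorphic_on unit_disk"
  using assms by (rule holomorphic_transform) (simp add: zero_off_disk_def)

lemma zero_off_disk_in_H_inf:
  assumes "f holomorphic_on unit_disk" "\<And>z. z \<in> unit_disk \<Longrightarrow> norm (f z) \<le> B"
  shows "zero_off_disk f \<in> H_inf"
  using assms
  by (intro H_infI[where B = B] zero_off_disk_holomorphic) (auto simp: zero_off_disk_def)

lemma norm_le_H_inf_norm:
  assumes "f \<in> H_inf" "z \<in> unit_disk"
  shows "norm (f z) \<le> H_inf_norm f"
proof -
  have "bdd_above ((\<lambda>z. norm (f z)) ` unit_disk)"
    using assms(1) by (auto simp: H_inf_def bounded_iff bdd_above_def)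
  then show ?thesis
    unfolding H_inf_norm_def using assms(2) by (rule cSUP_upper2) simp
qed

lemma H_inf_norm_le:
  assumes "\<And>z. z \<in> unit_disk \<Longrightarrow> norm (f z) \<le> B"
  shows "H_inf_norm f \<le> B"
  unfolding H_inf_norm_def by (rule cSUP_least) (use assms in auto)

lemma H_inf_norm_nonneg: "f \<in> H_inf \<Longrightarrow> 0 \<le> H_inf_norm f"
  using norm_le_H_inf_norm[of f 0] norm_ge_zero[of "f 0"] by (simp del: norm_ge_zero)

lemma H_inf_add:
  assumes "f \<in> H_inf" "h \<in> H_inf"
  shows "(\<lambda>z. f z + h z) \<in> H_inf"
proof (rule H_infI)
  show "norm (f z + h z) \<le> H_inf_norm f + H_inf_norm h" if "z \<in> unit_disk" for z
    using norm_triangle_ineq[of "f z" "h z"] norm_le_H_inf_norm[OF assms(1) that]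
      norm_le_H_inf_norm[OF assms(2) that] by linarith
qed (use assms in \<open>auto intro!: holomorphic_intros simp: H_inf_holomorphic H_inf_off_disk\<close>)

lemma H_inf_cmult:
  assumes "f \<in> H_inf"
  shows "(\<lambda>z. c * f z) \<in> H_inf"
proof (rule H_infI)
  show "norm (c * f z) \<le> norm c * H_inf_norm f" if "z \<in> unit_disk" for z
    using norm_le_H_inf_norm[OF assms that] by (simp add: norm_mult mult_left_mono)
qed (use assms in \<open>auto intro!: holomorphic_intros simp: H_inf_holomorphic H_inf_off_disk\<close>)

lemma H_inf_diff:
  assumes "f \<in> H_inf" "h \<in> H_inf"
  shows "(\<lambda>z. f z - h z) \<in> H_inf"
  using H_inf_add[OF assms(1) H_inf_cmult[OF assms(2), of "-1"]] by simp

abbreviation one_disk :: "complex \<Rightarrow> complex" where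
  "one_disk \<equiv> zero_off_disk (\<lambda>_. 1)"

lemma one_disk_in_H_inf: "one_disk \<in> H_inf"
  by (rule zero_off_disk_in_H_inf[where B = 1]) auto

section \<open>Bounded operators\<close>

lemma bounded_operator_on_diff:
  assumes A: "bounded_operator_on H_inf H_inf_norm A"
    and B: "bounded_operator_on H_inf H_inf_norm B"
    and eq: "\<And>f. f \<in> H_inf \<Longrightarrow> D f = (\<lambda>z. A f z - B f z)"
  shows "bounded_operator_on H_inf H_inf_norm D"
proof -
  obtain a where a: "\<And>f. f \<in> H_inf \<Longrightarrow> H_inf_norm (A f) \<le> a * H_inf_norm f"
    using A unfolding bounded_operator_on_def by blast
  obtain b where b: "\<And>f. f \<in> H_inf \<Longrightarrow> H_inf_norm (B f) \<le> b * H_inf_norm f"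
    using B unfolding bounded_operator_on_def by blast
  have mem: "A f \<in> H_inf" "B f \<in> H_inf" if "f \<in> H_inf" for f
    using A B that by (auto simp: bounded_operator_on_def)
  have add: "A (\<lambda>z. f z + h z) = (\<lambda>z. A f z + A h z)" "B (\<lambda>z. f z + h z) = (\<lambda>z. B f z + B h z)"
    if "f \<in> H_inf" "h \<in> H_inf" for f h
    using A B that by (auto simp: bounded_operator_on_def)
  have cmult: "A (\<lambda>z. c * f z) = (\<lambda>z. c * A f z)" "B (\<lambda>z. c * f z) = (\<lambda>z. c * B f z)"
    if "f \<in> H_inf" for f c
    using A B that by (auto simp: bounded_operator_on_def)
  have "H_inf_norm (D f) \<le> (a + b) * H_inf_norm f" if f: "f \<in> H_inf" for f
  proof (rule H_inf_norm_le)
    fix z assume z: "z \<in> unit_disk"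
    have "norm (D f z) \<le> norm (A f z) + norm (B f z)"
      by (simp add: eq[OF f] norm_triangle_ineq4)
    then show "norm (D f z) \<le> (a + b) * H_inf_norm f"
      using norm_le_H_inf_norm[OF mem(1)[OF f] z] norm_le_H_inf_norm[OF mem(2)[OF f] z]
        a[OF f] b[OF f]
      by (simp add: algebra_simps)
  qed
  moreover have "D f \<in> H_inf" if "f \<in> H_inf" for f
    using H_inf_diff[OF mem[OF that]] eq[OF that] by simp
  moreover have "D (\<lambda>z. f z + h z) = (\<lambda>z. D f z + D h z)" if "f \<in> H_inf" "h \<in> H_inf" for f h
    using that by (simp add: eq H_inf_add add algebra_simps)
  moreover have "D (\<lambda>z. c * f z) = (\<lambda>z. c * D f z)" if "f \<in> H_inf" for f c
    using that by (simp add: eq H_inf_cmult cmult algebra_simps)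
  ultimately show ?thesis
    unfolding bounded_operator_on_def by blast
qed

lemma bounded_M_op:
  assumes g: "g \<in> H_inf"
  shows "bounded_operator_on H_inf H_inf_norm (M_op g)"
proof -
  have le: "norm (f z * g z) \<le> H_inf_norm g * H_inf_norm f" if "f \<in> H_inf" "z \<in> unit_disk" for f z
    using mult_mono[OF norm_le_H_inf_norm[OF g that(2)] norm_le_H_inf_norm[OF that]
        H_inf_norm_nonneg[OF g] norm_ge_zero]
    by (simp add: norm_mult mult.commute)
  have "M_op g f \<in> H_inf" if "f \<in> H_inf" for f
    unfolding M_op_def
    by (rule zero_off_disk_in_H_inf[OF _ le[OF that]])
       (intro holomorphic_on_mult H_inf_holomorphic that g)
  moreover have "H_inf_norm (M_op g f) \<le> H_inf_norm g * H_inf_norm f" if "f \<in> H_inf" for f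
    using le[OF that] by (intro H_inf_norm_le) (simp add: M_op_def zero_off_disk_def)
  moreover have "M_op g (\<lambda>z. f z + h z) = (\<lambda>z. M_op g f z + M_op g h z)"
    "M_op g (\<lambda>z. c * f z) = (\<lambda>z. c * M_op g f z)" for f h c
    by (auto simp: M_op_def zero_off_disk_def algebra_simps)
  ultimately show ?thesis
    unfolding bounded_operator_on_def by blast
qed

lemma bounded_point_evaluation:
  "bounded_operator_on H_inf H_inf_norm (\<lambda>f. zero_off_disk (\<lambda>_. f 0 * c))"
proof -
  have "zero_off_disk (\<lambda>_. f 0 * c) \<in> H_inf" for f :: "complex \<Rightarrow> complex"
    by (rule zero_off_disk_in_H_inf[where B = "norm (f 0 * c)"]) auto
  moreover have "H_inf_norm (zero_off_disk (\<lambda>_. f 0 * c)) \<le> norm c * H_inf_norm f"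
    if "f \<in> H_inf" for f
  proof (rule H_inf_norm_le)
    show "norm (zero_off_disk (\<lambda>_. f 0 * c) z) \<le> norm c * H_inf_norm f" if "z \<in> unit_disk" for z
      using norm_le_H_inf_norm[OF \<open>f \<in> H_inf\<close>, of 0] that
      by (simp add: zero_off_disk_def norm_mult mult.commute[of "norm c"] mult_right_mono)
  qed
  moreover have
    "zero_off_disk (\<lambda>_. (f 0 + h 0) * c) =
       (\<lambda>z. zero_off_disk (\<lambda>_. f 0 * c) z + zero_off_disk (\<lambda>_. h 0 * c) z)"
    "zero_off_disk (\<lambda>_. (a * f 0) * c) = (\<lambda>z. a * zero_off_disk (\<lambda>_. f 0 * c) z)"
    for f h :: "complex \<Rightarrow> complex" and a
    by (auto simp: zero_off_disk_def algebra_simps)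
  ultimately show ?thesis
    unfolding bounded_operator_on_def by blast
qed

section \<open>Integration by parts\<close>

lemma contour_integral_linepath_primitive:
  assumes "\<And>t. t \<in> unit_disk \<Longrightarrow> (F has_field_derivative u t) (at t)" "z \<in> unit_disk"
  shows "contour_integral (linepath 0 z) u = F z - F 0"
proof -
  have "closed_segment 0 z \<subseteq> unit_disk"
    using assms(2) by (intro closed_segment_subset) auto
  then have "(u has_contour_integral F z - F 0) (linepath 0 z)"
    using contour_integral_primitive[of unit_disk F u "linepath 0 z"] assms(1)
    by (auto intro: has_field_derivative_at_within)
  then show ?thesis
    by (rule contour_integral_unique)
qed

lemma S_op_primitive:
  assumes "f \<in> H_disk" "g \<in> H_disk"
  obtains F where "\<And>z. z \<in> unit_disk \<Longrightarrow> (F has_field_derivative deriv f z * g z) (at z)"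
    and "\<And>z. z \<in> unit_disk \<Longrightarrow> S_op g f z = F z - F 0"
proof -
  have "(\<lambda>t. deriv f t * g t) holomorphic_on unit_disk"
    using assms by (auto simp: H_disk_def intro!: holomorphic_intros)
  then obtain F where
    "\<And>z. z \<in> unit_disk \<Longrightarrow> (F has_field_derivative deriv f z * g z) (at z within unit_disk)"
    using holomorphic_convex_primitive'[OF convex_ball open_ball] by blast
  then have F: "(F has_field_derivative deriv f z * g z) (at z)" if "z \<in> unit_disk" for z
    using that at_within_open[OF that open_ball] by metis
  show thesis
    using contour_integral_linepath_primitive[OF F]
    by (intro that[OF F]) (auto simp: S_op_def zero_off_disk_def)
qed

lemma T_op_plus_S_op:
  assumes "f \<in> H_disk" "g \<in> H_disk"
  shows "T_op g f z + S_op g f z = M_op g f z - zero_off_disk (\<lambda>_. f 0 * g 0) z"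
proof (cases "z \<in> unit_disk")
  case True
  obtain F where F: "\<And>z. z \<in> unit_disk \<Longrightarrow> (F has_field_derivative deriv f z * g z) (at z)"
    and S: "\<And>z. z \<in> unit_disk \<Longrightarrow> S_op g f z = F z - F 0"
    using S_op_primitive[OF assms] by blast
  have "((\<lambda>z. f z * g z - F z) has_field_derivative f t * deriv g t) (at t)"
    if t: "t \<in> unit_disk" for t
  proof -
    have "(f has_field_derivative deriv f t) (at t)" "(g has_field_derivative deriv g t) (at t)"
      using assms t by (auto simp: H_disk_def intro: holomorphic_derivI[OF _ open_ball])
    then show ?thesis
      by (auto intro!: derivative_eq_intros F[OF t] simp: algebra_simps)
  qed
  from contour_integral_linepath_primitive[OF this True] True S[OF True] show ?thesis
    by (simp add: T_op_def M_op_def zero_off_disk_def)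
qed (auto simp: T_op_def S_op_def M_op_def zero_off_disk_def)

text \<open>
  The identity expresses each of \<open>T\<^sub>g\<close>, \<open>S\<^sub>g\<close> as the difference of an operator that is bounded
  for bounded \<open>g\<close> and the other one.
\<close>

lemma bounded_T_op_iff_S_op:
  assumes g: "g \<in> H_inf"
  shows "bounded_operator_on H_inf H_inf_norm (T_op g) \<longleftrightarrow>
         bounded_operator_on H_inf H_inf_norm (S_op g)"
proof -
  define P where "P = (\<lambda>f z. M_op g f z - zero_off_disk (\<lambda>_. f 0 * g 0) z)"
  have P: "bounded_operator_on H_inf H_inf_norm P"
    by (rule bounded_operator_on_diff[OF bounded_M_op[OF g] bounded_point_evaluation[of "g 0"]])
       (simp add: P_def)
  have parts: "P f z = T_op g f z + S_op g f z" if "f \<in> H_inf" for f z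
    using T_op_plus_S_op[of f g z] that g by (simp add: P_def H_inf_def)
  show ?thesis
  proof
    assume "bounded_operator_on H_inf H_inf_norm (T_op g)"
    with P show "bounded_operator_on H_inf H_inf_norm (S_op g)"
      by (rule bounded_operator_on_diff) (simp add: parts)
  next
    assume "bounded_operator_on H_inf H_inf_norm (S_op g)"
    with P show "bounded_operator_on H_inf H_inf_norm (T_op g)"
      by (rule bounded_operator_on_diff) (simp add: parts)
  qed
qed

section \<open>Bounded operators have bounded symbols\<close>

lemma symbol_M_imp_H_inf:
  assumes "g \<in> symbols M_op H_inf H_inf_norm"
  shows "g \<in> H_inf"
proof -
  have "M_op g one_disk \<in> H_inf"
    using assms one_disk_in_H_inf by (auto simp: symbols_def bounded_operator_on_def)
  moreover have "M_op g one_disk = g"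
    using assms by (auto simp: symbols_def H_disk_def M_op_def zero_off_disk_def)
  ultimately show ?thesis by simp
qed

lemma symbol_T_imp_H_inf:
  assumes "g \<in> symbols T_op H_inf H_inf_norm"
  shows "g \<in> H_inf"
proof -
  have g: "g \<in> H_disk" and T: "T_op g one_disk \<in> H_inf"
    using assms one_disk_in_H_inf by (auto simp: symbols_def bounded_operator_on_def)
  have "(g has_field_derivative one_disk t * deriv g t) (at t)" if "t \<in> unit_disk" for t
    using that g holomorphic_derivI[OF _ open_ball that, of g]
    by (simp add: H_disk_def zero_off_disk_def)
  from contour_integral_linepath_primitive[OF this]
  have "g z = T_op g one_disk z + g 0 * one_disk z" for z
    using g by (auto simp: T_op_def zero_off_disk_def H_disk_def)
  then have "g = (\<lambda>z. T_op g one_disk z + g 0 * one_disk z)" ..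
  with H_inf_add[OF T H_inf_cmult[OF one_disk_in_H_inf]] show ?thesis by metis
qed

text \<open>
  The Cauchy estimate on the circle about \<open>w\<close> of radius \<open>(1 - |w|) / 2\<close>, half the distance
  from \<open>w\<close> to the boundary, so that the closed disk it bounds stays inside the unit disk.
\<close>

lemma H_inf_deriv_bound:
  assumes h: "h \<in> H_inf" and w: "w \<in> unit_disk"
  shows "norm (deriv h w) * (1 - norm w) \<le> 2 * H_inf_norm h"
proof -
  define r where "r = (1 - norm w) / 2"
  have r: "0 < r" using w by (simp add: r_def)
  have sub: "cball w r \<subseteq> unit_disk"
  proof
    fix x assume "x \<in> cball w r"
    then have "norm x \<le> norm w + r"
      using norm_triangle_sub[of x w] by (simp add: dist_norm norm_minus_commute)
    then show "x \<in> unit_disk" using w by (simp add: r_def field_simps)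
  qed
  have "norm ((deriv ^^ 1) h w) \<le> fact 1 * H_inf_norm h / r ^ 1"
  proof (rule Cauchy_inequality[OF _ _ r])
    show "h holomorphic_on ball w r"
      using H_inf_holomorphic[OF h] sub by (meson ball_subset_cball holomorphic_on_subset order_trans)
    show "continuous_on (cball w r) h"
      using H_inf_holomorphic[OF h] sub by (meson holomorphic_on_imp_continuous_on holomorphic_on_subset)
    show "norm (h x) \<le> H_inf_norm h" if "norm (w - x) = r" for x
      using that sub by (intro norm_le_H_inf_norm[OF h]) (auto simp: dist_norm)
  qed
  then show ?thesis using r by (simp add: r_def field_simps)
qed

lemma disk_automorphism_in_H_inf:
  assumes w: "w \<in> unit_disk"
  shows "zero_off_disk (Moebius_function 0 w) \<in> H_inf"
    and "H_inf_norm (zero_off_disk (Moebius_function 0 w)) \<le> 1"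
proof -
  have le: "norm (Moebius_function 0 w z) \<le> 1" if "z \<in> unit_disk" for z
    using Moebius_function_norm_lt_1[of w z 0] w that by simp
  show "zero_off_disk (Moebius_function 0 w) \<in> H_inf"
    using w by (intro zero_off_disk_in_H_inf[OF _ le] Moebius_function_holomorphic) auto
  show "H_inf_norm (zero_off_disk (Moebius_function 0 w)) \<le> 1"
    using le by (intro H_inf_norm_le) (simp add: zero_off_disk_def)
qed

lemma disk_automorphism_deriv:
  assumes w: "w \<in> unit_disk"
  shows "deriv (zero_off_disk (Moebius_function 0 w)) w = 1 / of_real (1 - (norm w)\<^sup>2)"
proof -
  have sq: "cnj w * w = of_real ((norm w)\<^sup>2)"
    using complex_norm_square[of w] by (simp add: mult.commute)
  have "(norm w)\<^sup>2 < 1"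
    using w by (simp add: power_less_one_iff abs_square_less_1)
  then have ne: "1 - complex_of_real ((norm w)\<^sup>2) \<noteq> 0"
    by (metis eq_iff_diff_eq_0 less_irrefl of_real_1 of_real_eq_iff)
  have "(Moebius_function 0 w has_field_derivative 1 / of_real (1 - (norm w)\<^sup>2)) (at w)"
    unfolding Moebius_function_def
    by (rule derivative_eq_intros refl | use ne sq in simp)+
  then have "(zero_off_disk (Moebius_function 0 w) has_field_derivative
      1 / of_real (1 - (norm w)\<^sup>2)) (at w)"
    by (rule has_field_derivative_transform_within_open[OF _ open_ball w])
       (simp add: zero_off_disk_def)
  then show ?thesis by (rule DERIV_imp_deriv)
qed

text \<open>
  The automorphism \<open>\<phi>\<^sub>w\<close> turns the bound on the operator into a bound on \<open>g\<close> at the single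
  point \<open>w\<close>: the growth of \<open>\<phi>\<^sub>w'(w)\<close> at the boundary cancels the loss in the Cauchy estimate,
  which leaves the factor \<open>(1 - |w|\<^sup>2) / (1 - |w|) = 1 + |w| \<le> 2\<close>.
\<close>

lemma symbol_S_imp_H_inf:
  assumes "g \<in> symbols S_op H_inf H_inf_norm"
  shows "g \<in> H_inf"
proof -
  have g: "g \<in> H_disk" and mem: "\<And>f. f \<in> H_inf \<Longrightarrow> S_op g f \<in> H_inf"
    using assms by (auto simp: symbols_def bounded_operator_on_def)
  obtain C where C: "\<And>f. f \<in> H_inf \<Longrightarrow> H_inf_norm (S_op g f) \<le> C * H_inf_norm f"
    using assms unfolding symbols_def bounded_operator_on_def by blast
  have "norm (g w) \<le> 4 * \<bar>C\<bar>" if w: "w \<in> unit_disk" for w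
  proof -
    define f where "f = zero_off_disk (Moebius_function 0 w)"
    have f: "f \<in> H_inf" and "H_inf_norm f \<le> 1"
      using disk_automorphism_in_H_inf[OF w] by (simp_all add: f_def)
    then have "C * H_inf_norm f \<le> \<bar>C\<bar> * 1"
      using H_inf_norm_nonneg[OF f] by (intro mult_mono) auto
    with C[OF f] have S_le: "H_inf_norm (S_op g f) \<le> \<bar>C\<bar>" by simp
    obtain F where F: "\<And>z. z \<in> unit_disk \<Longrightarrow> (F has_field_derivative deriv f z * g z) (at z)"
      and S: "\<And>z. z \<in> unit_disk \<Longrightarrow> S_op g f z = F z - F 0"
      using S_op_primitive[of f g] f g by (auto simp: H_inf_def)
    have "((\<lambda>z. F z - F 0) has_field_derivative deriv f w * g w) (at w)"
      by (auto intro!: derivative_eq_intros F[OF w])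
    then have "(S_op g f has_field_derivative deriv f w * g w) (at w)"
      by (rule has_field_derivative_transform_within_open[OF _ open_ball w]) (simp add: S)
    then have "deriv (S_op g f) w = g w / of_real (1 - (norm w)\<^sup>2)"
      using disk_automorphism_deriv[OF w] by (simp add: DERIV_imp_deriv f_def)
    moreover have pos: "0 < 1 - norm w" using w by simp
    moreover have sq: "1 - (norm w)\<^sup>2 = (1 - norm w) * (1 + norm w)"
      by (simp add: power2_eq_square algebra_simps)
    ultimately have "norm (deriv (S_op g f) w) * (1 - norm w) = norm (g w) / (1 + norm w)"
      by (simp only: norm_divide norm_of_real) (simp add: abs_mult)
    with H_inf_deriv_bound[OF mem[OF f] w] S_le
    have "norm (g w) / (1 + norm w) \<le> 2 * \<bar>C\<bar>" by linarith
    then have "norm (g w) \<le> 2 * \<bar>C\<bar> * (1 + norm w)"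
      by (subst (asm) pos_divide_le_eq) (auto intro: add_pos_nonneg)
    also have "\<dots> \<le> 2 * \<bar>C\<bar> * 2"
      using w by (intro mult_left_mono) auto
    finally show ?thesis by simp
  qed
  with g show ?thesis by (intro H_infI[of g]) (auto simp: H_disk_def)
qed

theorem proposition2p3:
  shows "symbols T_op H_inf H_inf_norm = symbols S_op H_inf H_inf_norm \<and>
         symbols S_op H_inf H_inf_norm \<subseteq> symbols M_op H_inf H_inf_norm \<and>
         symbols M_op H_inf H_inf_norm = H_inf"
proof -
  have M: "symbols M_op H_inf H_inf_norm = H_inf"
    using symbol_M_imp_H_inf bounded_M_op H_inf_subset unfolding symbols_def by blast
  have "g \<in> symbols T_op H_inf H_inf_norm \<longleftrightarrow> g \<in> symbols S_op H_inf H_inf_norm" for g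
    using symbol_T_imp_H_inf symbol_S_imp_H_inf bounded_T_op_iff_S_op[of g]
    unfolding symbols_def by blast
  with M show ?thesis
    using symbol_S_imp_H_inf by blast
qed

end
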